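(* Let $A$ be a $\mathbf{k}$-algebra and let $(V,\ell,r)$ be an $A$-bimodule, both with finite $\mathbf{k}$-dimension. Let $\alpha,\beta:V\to A$ be two $\mathbf{k}$-linear maps and let $\kappa\in\mathbf{k}$. Let $\hat A=A\ltimes_{r^*,\ell^*}V^*$, and let $\tilde\alpha_-=\alpha-\alpha^{21}$ and $\tilde\beta_+=\beta+\beta^{21}$ in $\hat A\otimes\hat A$, identified as linear maps from $\hat A^*$ to $\hat A$. Then $\alpha$ is an extended $\mathcal{O}$-operator with modification $\beta$ of mass $\kappa$ (associated to the $A$-bimodule $(V,\ell,r)$) if and only if $\tilde\alpha_-$ is an extended $\mathcal{O}$-operator with modification $\tilde\beta_+$ of mass $\kappa$ (associated to the $\hat A$-bimodule $(\hat A^*,R^*_{\hat A},L^*_{\hat A})$).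
   Context: $\mathbf{k}$ is a field; a $\mathbf{k}$-algebra is associative, not necessarily unital. An $A$-bimodule $(V,\ell,r)$ is a vector space with linear maps $\ell,r:A\to\mathrm{End}_{\mathbf{k}}(V)$ (left, right) with $\ell(xy)v=\ell(x)(\ell(y)v)$, $v\,r(xy)=(v\,r(x))r(y)$, $(\ell(x)v)r(y)=\ell(x)(v\,r(y))$. Its dual bimodule $(V^*,r^*,\ell^* )$ has left action $\langle r^*(x)u^*,v\rangle=\langle u^*,v\,r(x)\rangle$ and right action $\langle u^*\ell^*(x),v\rangle=\langle u^*,\ell(x)v\rangle$. $\hat A=A\ltimes_{r^*,\ell^*}V^*$ is the algebra $A\oplus V^*$ with product $(x,u^* )(y,v^* )=(xy,\,r^*(x)v^*+u^*\ell^*(y))$. For an algebra $C$, $(C^*,R_C^*,L_C^* )$ denotes the dual of the bimodule $C$: $\langle R_C^*(x)c^*,y\rangle=\langle c^*,yx\rangle$, $\langle c^*L_C^*(x),y\rangle=\langle c^*,xy\rangle$. A linear map $\gamma:V\to A$ is identified with an element of $\hat A\otimes\hat A$ via $\mathrm{Hom}_{\mathbf{k}}(V,A)\cong A\otimes V^*\subset\hat A\otimes\hat A$, i.e. $\gamma=\sum_i\gamma(e_i)\otimes e_i^*$ for a basis $(e_i)$ of $V$ with dual basis $(e_i^* )$; $\gamma^{21}=\sum_i e_i^*\otimes\gamma(e_i)$. An element $s=\sum_i s_i\otimes t_i\in\hat A\otimes\hat A$ is identified with the linear map $\hat A^*\to\hat A$, $u\mapsto\sum_i\langle u,s_i\rangle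 t_i$. For an algebra $C$ and a $C$-bimodule $(W,\ell,r)$, a linear map $\beta:W\to C$ is a balanced $C$-bimodule homomorphism of mass $\kappa$ if $\beta(\ell(x)w)=x\beta(w)$, $\beta(w\,r(x))=\beta(w)x$ and $\kappa\,\ell(\beta(u))v=\kappa\,u\,r(\beta(v))$. For $\kappa\neq 0$, a linear map $\alpha:W\to C$ is an extended $\mathcal{O}$-operator with modification $\beta$ of mass $\kappa$ if $\beta$ is a balanced $C$-bimodule homomorphism of mass $\kappa$ and $\alpha(u)\alpha(v)-\alpha(\ell(\alpha(u))v+u\,r(\alpha(v)))=\kappa\,\beta(u)\beta(v)$ for all $u,v\in W$. For $\kappa=0$ the modification plays no role, and $\alpha$ is an extended $\mathcal{O}$-operator of mass $0$ if it is an $\mathcal{O}$-operator: $\alpha(u)\alpha(v)=\alpha(\ell(\alpha(u))v+u\,r(\alpha(v)))$ for all $u,v\in W$. *)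

theory Defs
  imports
    "HOL-Library.Function_Algebras"
    "HOL-Library.Product_Plus"
    "HOL-Library.Poly_Mapping"
    Complex_Main
begin

(* Dual spaces are not types of their own (the scalar multiplication is a parameter), so a
   vector space is a subspace C of an ambient type with a scalar multiplication s :: 'k => 'c => 'c.
   A space filling its whole type has carrier UNIV. *)

definition linear_on ::
  "('k::field \<Rightarrow> 'w::ab_group_add \<Rightarrow> 'w) \<Rightarrow> 'w set \<Rightarrow> ('k \<Rightarrow> 'c::ab_group_add \<Rightarrow> 'c) \<Rightarrow> 'c set
    \<Rightarrow> ('w \<Rightarrow> 'c) \<Rightarrow> bool"
where
  "linear_on sW W sC C f \<longleftrightarrow>
     (\<forall>u\<in>W. f u \<in> C) \<and>
     (\<forall>u\<in>W. \<forall>v\<in>W. f (u + v) = f u + f v) \<and>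
     (\<forall>c. \<forall>u\<in>W. f (sW c u) = sC c (f u))"


subsection \<open>Algebras and bimodules\<close>

locale algebra_on = vector_space scale
  for scale :: "'k::field \<Rightarrow> 'c::ab_group_add \<Rightarrow> 'c" +
  fixes C :: "'c set" and mult :: "'c \<Rightarrow> 'c \<Rightarrow> 'c"
  assumes subspace_carrier: "subspace C"
    and linear_mult_left: "y \<in> C \<Longrightarrow> linear_on scale C scale C (\<lambda>x. mult x y)"
    and linear_mult_right: "x \<in> C \<Longrightarrow> linear_on scale C scale C (mult x)"
    and mult_assoc:
      "x \<in> C \<Longrightarrow> y \<in> C \<Longrightarrow> z \<in> C \<Longrightarrow> mult (mult x y) z = mult x (mult y z)"

(* Right actions are written prefix: r x w stands for "w r(x)". *)

locale bimodule_on = algebra_on sC C mult + W: vector_space sW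
  for sC :: "'k::field \<Rightarrow> 'c::ab_group_add \<Rightarrow> 'c" and C :: "'c set" and mult :: "'c \<Rightarrow> 'c \<Rightarrow> 'c"
    and sW :: "'k \<Rightarrow> 'w::ab_group_add \<Rightarrow> 'w" +
  fixes W :: "'w set" and l r :: "'c \<Rightarrow> 'w \<Rightarrow> 'w"
  assumes subspace_module: "W.subspace W"
    and linear_l: "x \<in> C \<Longrightarrow> linear_on sW W sW W (l x)"
    and linear_r: "x \<in> C \<Longrightarrow> linear_on sW W sW W (r x)"
    and linear_l_arg: "w \<in> W \<Longrightarrow> linear_on sC C sW W (\<lambda>x. l x w)"
    and linear_r_arg: "w \<in> W \<Longrightarrow> linear_on sC C sW W (\<lambda>x. r x w)"
    and l_mult: "x \<in> C \<Longrightarrow> y \<in> C \<Longrightarrow> w \<in> W \<Longrightarrow> l (mult x y) w = l x (l y w)"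
    and r_mult: "x \<in> C \<Longrightarrow> y \<in> C \<Longrightarrow> w \<in> W \<Longrightarrow> r (mult x y) w = r y (r x w)"
    and l_r: "x \<in> C \<Longrightarrow> y \<in> C \<Longrightarrow> w \<in> W \<Longrightarrow> r y (l x w) = l x (r y w)"


subsection \<open>Dual spaces and dual bimodules\<close>

definition fun_scale :: "'k::field \<Rightarrow> ('w \<Rightarrow> 'k) \<Rightarrow> 'w \<Rightarrow> 'k" where
  "fun_scale c f = (\<lambda>w. c * f w)"

(* A functional on W is represented by its extension by 0 outside W, which makes the
   representation unique. *)

definition dual_space ::
  "('k::field \<Rightarrow> 'w::ab_group_add \<Rightarrow> 'w) \<Rightarrow> 'w set \<Rightarrow> ('w \<Rightarrow> 'k) set"
where
  "dual_space sW W = {f. linear_on sW W (*) UNIV f \<and> (\<forall>w. w \<notin> W \<longrightarrow> f w = 0)}"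

(* The transpose of an action: the left action r^* of the dual bimodule is dual_action W r,
   its right action l^* is dual_action W l. *)

definition dual_action ::
  "'w set \<Rightarrow> ('c \<Rightarrow> 'w \<Rightarrow> 'w) \<Rightarrow> 'c \<Rightarrow> ('w \<Rightarrow> 'k::field) \<Rightarrow> 'w \<Rightarrow> 'k"
where
  "dual_action W act x f = (\<lambda>w. if w \<in> W then f (act x w) else 0)"

definition left_mult :: "('c \<Rightarrow> 'c \<Rightarrow> 'c) \<Rightarrow> 'c \<Rightarrow> 'c \<Rightarrow> 'c" where
  "left_mult mult x y = mult x y"

definition right_mult :: "('c \<Rightarrow> 'c \<Rightarrow> 'c) \<Rightarrow> 'c \<Rightarrow> 'c \<Rightarrow> 'c" where
  "right_mult mult x y = mult y x"


subsection \<open>The algebra $A \ltimes_{r^*,\ell^*} V^*$\<close>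

definition hat_scale ::
  "('k::field \<Rightarrow> 'a \<Rightarrow> 'a) \<Rightarrow> 'k \<Rightarrow> 'a \<times> ('v \<Rightarrow> 'k) \<Rightarrow> 'a \<times> ('v \<Rightarrow> 'k)"
where
  "hat_scale sA c = map_prod (sA c) (fun_scale c)"

definition hat_carrier ::
  "('k::field \<Rightarrow> 'v::ab_group_add \<Rightarrow> 'v) \<Rightarrow> ('a \<times> ('v \<Rightarrow> 'k)) set"
where
  "hat_carrier sV = UNIV \<times> dual_space sV UNIV"

definition hat_mult ::
  "('a \<Rightarrow> 'a \<Rightarrow> 'a) \<Rightarrow> ('a \<Rightarrow> 'v \<Rightarrow> 'v) \<Rightarrow> ('a \<Rightarrow> 'v \<Rightarrow> 'v)
    \<Rightarrow> 'a \<times> ('v \<Rightarrow> 'k::field) \<Rightarrow> 'a \<times> ('v \<Rightarrow> 'k) \<Rightarrow> 'a \<times> ('v \<Rightarrow> 'k)"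
where
  "hat_mult mult l r p q =
     (mult (fst p) (fst q),
      dual_action UNIV r (fst p) (snd q) + dual_action UNIV l (fst q) (snd p))"


subsection \<open>Tensors\<close>

(* The tensor square of C is the free vector space on C x C modulo the bilinearity relations;
   an element is a coset of formal linear combinations. *)

definition free_scale :: "'k::field \<Rightarrow> ('b \<Rightarrow>\<^sub>0 'k) \<Rightarrow> ('b \<Rightarrow>\<^sub>0 'k)" where
  "free_scale c p = Poly_Mapping.map ((*) c) p"

definition tensor_relations ::
  "('k::field \<Rightarrow> 'c::ab_group_add \<Rightarrow> 'c) \<Rightarrow> 'c set \<Rightarrow> (('c \<times> 'c) \<Rightarrow>\<^sub>0 'k) set"
where
  "tensor_relations sC C =
     {Poly_Mapping.single (x + y, z) 1 - Poly_Mapping.single (x, z) 1 - Poly_Mapping.single (y, z) 1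
        | x y z. x \<in> C \<and> y \<in> C \<and> z \<in> C} \<union>
     {Poly_Mapping.single (z, x + y) 1 - Poly_Mapping.single (z, x) 1 - Poly_Mapping.single (z, y) 1
        | x y z. x \<in> C \<and> y \<in> C \<and> z \<in> C} \<union>
     {Poly_Mapping.single (sC c x, z) 1 - Poly_Mapping.single (x, z) c
        | c x z. x \<in> C \<and> z \<in> C} \<union>
     {Poly_Mapping.single (z, sC c x) 1 - Poly_Mapping.single (z, x) c
        | c x z. x \<in> C \<and> z \<in> C}"

definition tensor_class ::
  "('k::field \<Rightarrow> 'c::ab_group_add \<Rightarrow> 'c) \<Rightarrow> 'c set
    \<Rightarrow> (('c \<times> 'c) \<Rightarrow>\<^sub>0 'k) \<Rightarrow> (('c \<times> 'c) \<Rightarrow>\<^sub>0 'k) set"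
where
  "tensor_class sC C p = {q. q - p \<in> module.span free_scale (tensor_relations sC C)}"

definition tensor_add :: "('b \<Rightarrow>\<^sub>0 'k::field) set \<Rightarrow> ('b \<Rightarrow>\<^sub>0 'k) set \<Rightarrow> ('b \<Rightarrow>\<^sub>0 'k) set" where
  "tensor_add S T = {p + q | p q. p \<in> S \<and> q \<in> T}"

definition tensor_diff :: "('b \<Rightarrow>\<^sub>0 'k::field) set \<Rightarrow> ('b \<Rightarrow>\<^sub>0 'k) set \<Rightarrow> ('b \<Rightarrow>\<^sub>0 'k) set" where
  "tensor_diff S T = {p - q | p q. p \<in> S \<and> q \<in> T}"

definition formal_map ::
  "('k::field \<Rightarrow> 'c::ab_group_add \<Rightarrow> 'c) \<Rightarrow> (('c \<times> 'c) \<Rightarrow>\<^sub>0 'k) \<Rightarrow> ('c \<Rightarrow> 'k) \<Rightarrow> 'c"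
where
  "formal_map sC p u =
     (\<Sum>(s, t)\<in>Poly_Mapping.keys p. sC (Poly_Mapping.lookup p (s, t) * u s) t)"

(* The value does not depend on the chosen representative: lemma tensor_map_class below. *)

definition tensor_map ::
  "('k::field \<Rightarrow> 'c::ab_group_add \<Rightarrow> 'c) \<Rightarrow> (('c \<times> 'c) \<Rightarrow>\<^sub>0 'k) set \<Rightarrow> ('c \<Rightarrow> 'k) \<Rightarrow> 'c"
where
  "tensor_map sC T u = formal_map sC (SOME p. p \<in> T) u"

definition dual_basis ::
  "('k::field \<Rightarrow> 'v::ab_group_add \<Rightarrow> 'v) \<Rightarrow> 'v set \<Rightarrow> 'v \<Rightarrow> 'v \<Rightarrow> 'k"
where
  "dual_basis sV B e = (\<lambda>v. module.representation sV B v e)"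

(* For a finite basis B of V: the tensors of gamma and of gamma^21. *)

definition hom_tensor ::
  "('k::field \<Rightarrow> 'a::ab_group_add \<Rightarrow> 'a) \<Rightarrow> ('k \<Rightarrow> 'v::ab_group_add \<Rightarrow> 'v) \<Rightarrow> 'v set \<Rightarrow> ('v \<Rightarrow> 'a)
    \<Rightarrow> ((('a \<times> ('v \<Rightarrow> 'k)) \<times> ('a \<times> ('v \<Rightarrow> 'k))) \<Rightarrow>\<^sub>0 'k) set"
where
  "hom_tensor sA sV B \<gamma> = tensor_class (hat_scale sA) (hat_carrier sV)
     (\<Sum>e\<in>B. Poly_Mapping.single ((\<gamma> e, 0), (0, dual_basis sV B e)) 1)"

definition hom_tensor21 ::
  "('k::field \<Rightarrow> 'a::ab_group_add \<Rightarrow> 'a) \<Rightarrow> ('k \<Rightarrow> 'v::ab_group_add \<Rightarrow> 'v) \<Rightarrow> 'v set \<Rightarrow> ('v \<Rightarrow> 'a)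
    \<Rightarrow> ((('a \<times> ('v \<Rightarrow> 'k)) \<times> ('a \<times> ('v \<Rightarrow> 'k))) \<Rightarrow>\<^sub>0 'k) set"
where
  "hom_tensor21 sA sV B \<gamma> = tensor_class (hat_scale sA) (hat_carrier sV)
     (\<Sum>e\<in>B. Poly_Mapping.single ((0, dual_basis sV B e), (\<gamma> e, 0)) 1)"


subsection \<open>Extended $\mathcal{O}$-operators\<close>

definition balanced_hom ::
  "('k::field \<Rightarrow> 'c::ab_group_add \<Rightarrow> 'c) \<Rightarrow> 'c set \<Rightarrow> ('c \<Rightarrow> 'c \<Rightarrow> 'c)
    \<Rightarrow> ('k \<Rightarrow> 'w::ab_group_add \<Rightarrow> 'w) \<Rightarrow> 'w set \<Rightarrow> ('c \<Rightarrow> 'w \<Rightarrow> 'w) \<Rightarrow> ('c \<Rightarrow> 'w \<Rightarrow> 'w)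
    \<Rightarrow> 'k \<Rightarrow> ('w \<Rightarrow> 'c) \<Rightarrow> bool"
where
  "balanced_hom sC C mult sW W l r \<kappa> \<beta> \<longleftrightarrow>
     linear_on sW W sC C \<beta> \<and>
     (\<forall>x\<in>C. \<forall>w\<in>W. \<beta> (l x w) = mult x (\<beta> w)) \<and>
     (\<forall>x\<in>C. \<forall>w\<in>W. \<beta> (r x w) = mult (\<beta> w) x) \<and>
     (\<forall>u\<in>W. \<forall>v\<in>W. sW \<kappa> (l (\<beta> u) v) = sW \<kappa> (r (\<beta> v) u))"

definition O_operator ::
  "('k::field \<Rightarrow> 'c::ab_group_add \<Rightarrow> 'c) \<Rightarrow> 'c set \<Rightarrow> ('c \<Rightarrow> 'c \<Rightarrow> 'c)
    \<Rightarrow> ('k \<Rightarrow> 'w::ab_group_add \<Rightarrow> 'w) \<Rightarrow> 'w set \<Rightarrow> ('c \<Rightarrow> 'w \<Rightarrow> 'w) \<Rightarrow> ('c \<Rightarrow> 'w \<Rightarrow> 'w)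
    \<Rightarrow> ('w \<Rightarrow> 'c) \<Rightarrow> bool"
where
  "O_operator sC C mult sW W l r \<alpha> \<longleftrightarrow>
     linear_on sW W sC C \<alpha> \<and>
     (\<forall>u\<in>W. \<forall>v\<in>W. mult (\<alpha> u) (\<alpha> v) = \<alpha> (l (\<alpha> u) v + r (\<alpha> v) u))"

(* In mass 0 the modification plays no role. *)

definition extended_O_operator ::
  "('k::field \<Rightarrow> 'c::ab_group_add \<Rightarrow> 'c) \<Rightarrow> 'c set \<Rightarrow> ('c \<Rightarrow> 'c \<Rightarrow> 'c)
    \<Rightarrow> ('k \<Rightarrow> 'w::ab_group_add \<Rightarrow> 'w) \<Rightarrow> 'w set \<Rightarrow> ('c \<Rightarrow> 'w \<Rightarrow> 'w) \<Rightarrow> ('c \<Rightarrow> 'w \<Rightarrow> 'w)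
    \<Rightarrow> ('w \<Rightarrow> 'c) \<Rightarrow> ('w \<Rightarrow> 'c) \<Rightarrow> 'k \<Rightarrow> bool"
where
  "extended_O_operator sC C mult sW W l r \<alpha> \<beta> \<kappa> \<longleftrightarrow>
     (if \<kappa> = 0 then O_operator sC C mult sW W l r \<alpha>
      else linear_on sW W sC C \<alpha> \<and>
        balanced_hom sC C mult sW W l r \<kappa> \<beta> \<and>
        (\<forall>u\<in>W. \<forall>v\<in>W. mult (\<alpha> u) (\<alpha> v) - \<alpha> (l (\<alpha> u) v + r (\<alpha> v) u)
            = sC \<kappa> (mult (\<beta> u) (\<beta> v))))"


subsection \<open>Well-definedness\<close>

lemma vector_space_free_scale: "vector_space free_scale"
proof -
  have "Poly_Mapping.lookup (free_scale c p) x = c * Poly_Mapping.lookup p x"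
    for c :: 'a and p :: "'b \<Rightarrow>\<^sub>0 'a" and x
    by (simp add: free_scale_def Poly_Mapping.map.rep_eq when_def)
  then show ?thesis
    by unfold_locales (auto intro!: poly_mapping_eqI simp: lookup_add algebra_simps)
qed

lemma vector_space_fun_scale: "vector_space fun_scale"
  by unfold_locales (auto simp: fun_scale_def algebra_simps)

lemma vector_space_hat_scale:
  assumes "vector_space sA"
  shows "vector_space (hat_scale sA)"
proof -
  interpret A: vector_space sA by fact
  show ?thesis
    by unfold_locales
      (auto simp: hat_scale_def fun_scale_def algebra_simps A.scale_right_distrib
        A.scale_left_distrib prod_eq_iff)
qed

lemma dual_space_UNIV: "dual_space sW UNIV = {f. linear_on sW UNIV (*) UNIV f}"
  by (simp add: dual_space_def)

lemma subspace_dual_space: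
  assumes "module.subspace sW W" "vector_space sW"
  shows "module.subspace fun_scale (dual_space sW W)"
proof -
  interpret F: vector_space "fun_scale :: 'a \<Rightarrow> ('b \<Rightarrow> 'a) \<Rightarrow> _" by (rule vector_space_fun_scale)
  show ?thesis
    by (auto simp: F.subspace_def dual_space_def linear_on_def fun_scale_def algebra_simps)
qed

lemma dual_bimodule:
  fixes sC :: "'k::field \<Rightarrow> 'c::ab_group_add \<Rightarrow> 'c" and sW :: "'k \<Rightarrow> 'w::ab_group_add \<Rightarrow> 'w"
  assumes "bimodule_on sC C mult sW W l r"
  shows "bimodule_on sC C mult fun_scale (dual_space sW W) (dual_action W r) (dual_action W l)"
proof -
  interpret bimodule_on sC C mult sW W l r by fact
  interpret F: vector_space "fun_scale :: 'k \<Rightarrow> ('w \<Rightarrow> 'k) \<Rightarrow> _" by (rule vector_space_fun_scale)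
  note L = linear_l[unfolded linear_on_def] linear_r[unfolded linear_on_def]
    linear_l_arg[unfolded linear_on_def] linear_r_arg[unfolded linear_on_def]
  note W = W.subspace_add[OF subspace_module] W.subspace_scale[OF subspace_module]
  have S: "F.subspace (dual_space sW W)"
    by (rule subspace_dual_space) (rule subspace_module, rule W.vector_space_axioms)
  show ?thesis
    by (rule bimodule_on.intro, rule algebra_on_axioms, rule F.vector_space_axioms,
        rule bimodule_on_axioms.intro, rule S)
      (use L W in \<open>auto simp: linear_on_def dual_space_def dual_action_def fun_scale_def
        fun_eq_iff l_mult r_mult l_r\<close>)
qed

lemma regular_bimodule:
  assumes "algebra_on sC C mult"
  shows "bimodule_on sC C mult sC C (left_mult mult) (right_mult mult)"
proof -
  interpret algebra_on sC C mult by fact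
  have "left_mult mult x = mult x" "right_mult mult x = (\<lambda>y. mult y x)" for x
    by (auto simp: left_mult_def right_mult_def)
  then show ?thesis
    by unfold_locales
      (auto simp: subspace_carrier linear_mult_left linear_mult_right mult_assoc)
qed

lemma hat_algebra:
  fixes sA :: "'k::field \<Rightarrow> 'a::ab_group_add \<Rightarrow> 'a" and sV :: "'k \<Rightarrow> 'v::ab_group_add \<Rightarrow> 'v"
  assumes "bimodule_on sA UNIV mult sV UNIV l r"
  shows "algebra_on (hat_scale sA) (hat_carrier sV) (hat_mult mult l r)"
proof -
  interpret bimodule_on sA UNIV mult sV UNIV l r by fact
  interpret D: bimodule_on sA UNIV mult fun_scale "dual_space sV UNIV"
      "dual_action UNIV r" "dual_action UNIV l"
    by (rule dual_bimodule) fact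
  interpret H: vector_space "hat_scale sA :: 'k \<Rightarrow> 'a \<times> ('v \<Rightarrow> 'k) \<Rightarrow> _"
    by (rule vector_space_hat_scale) (rule vector_space_axioms)
  note L = linear_mult_left[unfolded linear_on_def] linear_mult_right[unfolded linear_on_def]
    D.linear_l[unfolded linear_on_def] D.linear_r[unfolded linear_on_def]
    D.linear_l_arg[unfolded linear_on_def] D.linear_r_arg[unfolded linear_on_def]
  note S = D.W.subspace_0[OF D.subspace_module] D.W.subspace_add[OF D.subspace_module]
    D.W.subspace_scale[OF D.subspace_module]
  show ?thesis
  proof unfold_locales
    show "H.subspace (hat_carrier sV)"
      using S by (auto simp: H.subspace_def hat_carrier_def hat_scale_def zero_prod_def)
  next
    fix y :: "'a \<times> ('v \<Rightarrow> 'k)" assume "y \<in> hat_carrier sV"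
    then show "linear_on (hat_scale sA) (hat_carrier sV) (hat_scale sA) (hat_carrier sV)
        (\<lambda>x. hat_mult mult l r x y)"
      using S L by (auto simp: linear_on_def hat_carrier_def hat_scale_def hat_mult_def
          D.W.scale_right_distrib)
  next
    fix x :: "'a \<times> ('v \<Rightarrow> 'k)" assume "x \<in> hat_carrier sV"
    then show "linear_on (hat_scale sA) (hat_carrier sV) (hat_scale sA) (hat_carrier sV)
        (hat_mult mult l r x)"
      using S L by (auto simp: linear_on_def hat_carrier_def hat_scale_def hat_mult_def
          D.W.scale_right_distrib)
  next
    fix x y z :: "'a \<times> ('v \<Rightarrow> 'k)"
    assume "x \<in> hat_carrier sV" "y \<in> hat_carrier sV" "z \<in> hat_carrier sV"
    then show "hat_mult mult l r (hat_mult mult l r x y) z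
        = hat_mult mult l r x (hat_mult mult l r y z)"
      using S L by (auto simp: hat_carrier_def hat_mult_def mult_assoc D.l_mult D.r_mult D.l_r
          add.assoc)
  qed
qed

lemma formal_map_eq_sum:
  assumes "vector_space sC" "finite K" "Poly_Mapping.keys p \<subseteq> K"
  shows "formal_map sC p u = (\<Sum>(s, t)\<in>K. sC (Poly_Mapping.lookup p (s, t) * u s) t)"
proof -
  interpret vector_space sC by fact
  show ?thesis
    unfolding formal_map_def using assms(2,3)
    by (intro sum.mono_neutral_left) (auto simp: in_keys_iff)
qed

lemma formal_map_add:
  assumes "vector_space sC"
  shows "formal_map sC (p + q) u = formal_map sC p u + formal_map sC q u"
proof -
  interpret vector_space sC by fact
  let ?K = "Poly_Mapping.keys p \<union> Poly_Mapping.keys q"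
  have *: "Poly_Mapping.keys (p + q) \<subseteq> ?K" by (rule Poly_Mapping.keys_add)
  show ?thesis
    by (simp add: formal_map_eq_sum[OF assms, of ?K] * lookup_add case_prod_unfold
        distrib_right scale_left_distrib sum.distrib)
qed

lemma formal_map_scale:
  assumes "vector_space sC"
  shows "formal_map sC (free_scale c p) u = sC c (formal_map sC p u)"
proof -
  interpret vector_space sC by fact
  have lk: "Poly_Mapping.lookup (free_scale c p) x = c * Poly_Mapping.lookup p x" for x
    by (simp add: free_scale_def Poly_Mapping.map.rep_eq when_def)
  then have *: "Poly_Mapping.keys (free_scale c p) \<subseteq> Poly_Mapping.keys p"
    by (auto simp: in_keys_iff)
  show ?thesis
    unfolding formal_map_eq_sum[OF assms finite_keys *]
    by (simp add: formal_map_def lk case_prod_unfold scale_sum_right mult.assoc)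
qed

lemma formal_map_diff:
  assumes "vector_space sC"
  shows "formal_map sC (p - q) u = formal_map sC p u - formal_map sC q u"
  using formal_map_add[OF assms, of "p - q" q u] by simp

lemma formal_map_single:
  assumes "vector_space sC"
  shows "formal_map sC (Poly_Mapping.single (s, t) c) u = sC (c * u s) t"
proof -
  interpret vector_space sC by fact
  show ?thesis by (simp add: formal_map_def)
qed

lemma formal_map_span:
  assumes C: "vector_space sC" and u: "u \<in> dual_space sC C"
    and p: "p \<in> module.span free_scale (tensor_relations sC C)"
  shows "formal_map sC p u = 0"
proof -
  interpret vector_space sC by fact
  interpret F: vector_space "free_scale :: 'a \<Rightarrow> (('b \<times> 'b) \<Rightarrow>\<^sub>0 'a) \<Rightarrow> _"
    by (rule vector_space_free_scale)
  show ?thesis using p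
  proof (induction rule: F.span_induct_alt)
    case base
    show ?case by (simp add: formal_map_def)
  next
    case (step c x y)
    have "formal_map sC x u = 0"
      using step(1) u
      by (auto simp: tensor_relations_def formal_map_diff[OF C] formal_map_single[OF C]
          dual_space_def linear_on_def scale_left_distrib scale_right_distrib mult.commute)
    then show ?case using step by (simp add: formal_map_add[OF C] formal_map_scale[OF C])
  qed
qed

lemma tensor_map_class:
  assumes C: "vector_space sC" and u: "u \<in> dual_space sC C"
  shows "tensor_map sC (tensor_class sC C p) u = formal_map sC p u"
proof -
  interpret F: vector_space "free_scale :: 'a \<Rightarrow> (('b \<times> 'b) \<Rightarrow>\<^sub>0 'a) \<Rightarrow> _"
    by (rule vector_space_free_scale)
  let ?q = "SOME q. q \<in> tensor_class sC C p"
  have "p \<in> tensor_class sC C p" by (simp add: tensor_class_def F.span_zero)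
  then have "?q \<in> tensor_class sC C p" by (rule someI)
  then have "formal_map sC (?q - p) u = 0"
    by (intro formal_map_span[OF C u]) (simp add: tensor_class_def)
  then show ?thesis by (simp add: tensor_map_def formal_map_diff[OF C])
qed

lemma tensor_add_class:
  fixes sC :: "'a::field \<Rightarrow> 'b::ab_group_add \<Rightarrow> 'b"
  shows "tensor_add (tensor_class sC C p) (tensor_class sC C q) = tensor_class sC C (p + q)"
proof -
  interpret F: vector_space "free_scale :: 'a \<Rightarrow> (('b \<times> 'b) \<Rightarrow>\<^sub>0 'a) \<Rightarrow> _"
    by (rule vector_space_free_scale)
  show ?thesis
  proof (intro set_eqI iffI)
    fix x assume "x \<in> tensor_add (tensor_class sC C p) (tensor_class sC C q)"
    then obtain p' q' where "x = p' + q'"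
      and "p' - p \<in> F.span (tensor_relations sC C)" "q' - q \<in> F.span (tensor_relations sC C)"
      by (auto simp: tensor_add_def tensor_class_def)
    moreover have "p' + q' - (p + q) = (p' - p) + (q' - q)" by simp
    ultimately show "x \<in> tensor_class sC C (p + q)"
      by (simp only: tensor_class_def mem_Collect_eq F.span_add)
  next
    fix x assume "x \<in> tensor_class sC C (p + q)"
    then have "x - q \<in> tensor_class sC C p" by (simp add: tensor_class_def algebra_simps)
    moreover have "q \<in> tensor_class sC C q" by (simp add: tensor_class_def F.span_zero)
    moreover have "x = (x - q) + q" by simp
    ultimately show "x \<in> tensor_add (tensor_class sC C p) (tensor_class sC C q)"
      unfolding tensor_add_def by blast
  qed
qed

lemma tensor_diff_class:
  fixes sC :: "'a::field \<Rightarrow> 'b::ab_group_add \<Rightarrow> 'b"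
  shows "tensor_diff (tensor_class sC C p) (tensor_class sC C q) = tensor_class sC C (p - q)"
proof -
  interpret F: vector_space "free_scale :: 'a \<Rightarrow> (('b \<times> 'b) \<Rightarrow>\<^sub>0 'a) \<Rightarrow> _"
    by (rule vector_space_free_scale)
  show ?thesis
  proof (intro set_eqI iffI)
    fix x assume "x \<in> tensor_diff (tensor_class sC C p) (tensor_class sC C q)"
    then obtain p' q' where "x = p' - q'"
      and "p' - p \<in> F.span (tensor_relations sC C)" "q' - q \<in> F.span (tensor_relations sC C)"
      by (auto simp: tensor_diff_def tensor_class_def)
    moreover have "p' - q' - (p - q) = (p' - p) - (q' - q)" by simp
    ultimately show "x \<in> tensor_class sC C (p - q)"
      by (simp only: tensor_class_def mem_Collect_eq F.span_diff)
  next
    fix x assume "x \<in> tensor_class sC C (p - q)"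
    then have "x + q \<in> tensor_class sC C p" by (simp add: tensor_class_def algebra_simps)
    moreover have "q \<in> tensor_class sC C q" by (simp add: tensor_class_def F.span_zero)
    moreover have "x = (x + q) - q" by simp
    ultimately show "x \<in> tensor_diff (tensor_class sC C p) (tensor_class sC C q)"
      unfolding tensor_diff_def by blast
  qed
qed

end

theory Submission
  imports Defs
begin

text \<open>
  Since $V$ is finite-dimensional, every functional on $\hat A = A \oplus V^*$ has the form
  $(a, w) \mapsto p(a) + w(x)$ with $p \in A^*$ and $x \in V$. In these coordinates
  $\tilde\alpha_-(p, x) = (-\alpha(x), p \circ \alpha)$ and
  $\tilde\beta_+(p, x) = (\beta(x), p \circ \beta)$. Put
  $E(x, y) = \alpha(x)\alpha(y) - \alpha(\ell(\alpha(x))y + x\,r(\alpha(y)))$; this is quadratic in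
  $\alpha$, hence insensitive to the sign. The corresponding expression for $\tilde\alpha_-$ at
  $(p, x), (q, y)$ is $(E(x, y),\ v \mapsto q(E(v, x)) + p(E(y, v)))$, and for a balanced $\beta$
  the product $\tilde\beta_+(p, x)\,\tilde\beta_+(q, y)$ has the same shape with
  $\beta(x)\beta(y)$ in place of $E(x, y)$. For the converse of the operator identity
  it suffices to take $p = q = 0$.
\<close>

section \<open>Sums of additive maps\<close>

text \<open>Elements of \<open>dual_space\<close> are additive only on their carrier, hence the
  domain \<open>D\<close>. Membership of the sum in \<open>D\<close> belongs to the conclusion
  because the induction step needs it before additivity applies.\<close>

lemma sum_additive_on:
  fixes G :: "'c::comm_monoid_add \<Rightarrow> 'd::comm_monoid_add"
  assumes "0 \<in> D" "\<And>x y. x \<in> D \<Longrightarrow> y \<in> D \<Longrightarrow> x + y \<in> D"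
    and "G 0 = 0" "\<And>x y. x \<in> D \<Longrightarrow> y \<in> D \<Longrightarrow> G (x + y) = G x + G y"
    and "\<And>e. e \<in> S \<Longrightarrow> h e \<in> D"
  shows "sum h S \<in> D \<and> G (sum h S) = (\<Sum>e\<in>S. G (h e))"
  using assms(5) by (induction S rule: infinite_finite_induct) (simp_all add: assms(1-4))

lemma sum_fun_scale_apply: "(\<Sum>e\<in>S. fun_scale (g e) (h e)) v = (\<Sum>e\<in>S. g e * h e v)"
  using sum_additive_on[of UNIV "\<lambda>f. f v" S "\<lambda>e. fun_scale (g e) (h e)"]
  by (simp add: fun_scale_def)

text \<open>The functional on the semidirect product with coordinates \<open>p\<close> and
  \<open>x\<close>. The default 0 follows the convention that elements of \<open>dual_space\<close>
  vanish outside the carrier, so that functionals can be compared as total functions.\<close>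

definition hat_functional ::
  "('k::field \<Rightarrow> 'v::ab_group_add \<Rightarrow> 'v) \<Rightarrow> ('a \<Rightarrow> 'k) \<Rightarrow> 'v \<Rightarrow> 'a \<times> ('v \<Rightarrow> 'k) \<Rightarrow> 'k"
where
  "hat_functional sV p x = (\<lambda>(a, w). if w \<in> dual_space sV UNIV then p a + w x else 0)"

locale fd_bimodule = bimodule_on sA UNIV mult sV UNIV l r + W: finite_dimensional_vector_space sV BV
  for sA :: "'k::field \<Rightarrow> 'a::ab_group_add \<Rightarrow> 'a" and mult :: "'a \<Rightarrow> 'a \<Rightarrow> 'a"
    and sV :: "'k \<Rightarrow> 'v::ab_group_add \<Rightarrow> 'v" and l r :: "'a \<Rightarrow> 'v \<Rightarrow> 'v" and BV :: "'v set"
begin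

sublocale F: vector_space "fun_scale :: 'k \<Rightarrow> ('v \<Rightarrow> 'k) \<Rightarrow> _"
  by (rule vector_space_fun_scale)

abbreviation dualA :: "('a \<Rightarrow> 'k) set" where "dualA \<equiv> dual_space sA UNIV"
abbreviation dualV :: "('v \<Rightarrow> 'k) set" where "dualV \<equiv> dual_space sV UNIV"
abbreviation hs :: "'k \<Rightarrow> 'a \<times> ('v \<Rightarrow> 'k) \<Rightarrow> 'a \<times> ('v \<Rightarrow> 'k)" where "hs \<equiv> hat_scale sA"
abbreviation hm :: "'a \<times> ('v \<Rightarrow> 'k) \<Rightarrow> 'a \<times> ('v \<Rightarrow> 'k) \<Rightarrow> 'a \<times> ('v \<Rightarrow> 'k)"
  where "hm \<equiv> hat_mult mult l r"
abbreviation H :: "('a \<times> ('v \<Rightarrow> 'k)) set" where "H \<equiv> hat_carrier sV"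
abbreviation \<Phi> :: "('a \<Rightarrow> 'k) \<Rightarrow> 'v \<Rightarrow> 'a \<times> ('v \<Rightarrow> 'k) \<Rightarrow> 'k" where "\<Phi> \<equiv> hat_functional sV"
abbreviation dual_left :: "'a \<times> ('v \<Rightarrow> 'k) \<Rightarrow> ('a \<times> ('v \<Rightarrow> 'k) \<Rightarrow> 'k) \<Rightarrow> 'a \<times> ('v \<Rightarrow> 'k) \<Rightarrow> 'k"
  where "dual_left \<equiv> dual_action H (right_mult hm)"
abbreviation dual_right :: "'a \<times> ('v \<Rightarrow> 'k) \<Rightarrow> ('a \<times> ('v \<Rightarrow> 'k) \<Rightarrow> 'k) \<Rightarrow> 'a \<times> ('v \<Rightarrow> 'k) \<Rightarrow> 'k"
  where "dual_right \<equiv> dual_action H (left_mult hm)"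

lemmas module_linear =
  linear_l[unfolded linear_on_def, simplified] linear_r[unfolded linear_on_def, simplified]
  linear_l_arg[unfolded linear_on_def, simplified] linear_r_arg[unfolded linear_on_def, simplified]

lemmas mult_linear =
  linear_mult_left[unfolded linear_on_def, simplified]
  linear_mult_right[unfolded linear_on_def, simplified]

section \<open>Functionals on A and V, and the dual basis\<close>

lemma dualV_D:
  assumes "w \<in> dualV"
  shows "w (x + y) = w x + w y" "w (sV c x) = c * w x"
  using assms by (auto simp: dual_space_def linear_on_def)

lemma dualA_D:
  assumes "p \<in> dualA"
  shows "p (x + y) = p x + p y" "p (sA c x) = c * p x"
  using assms by (auto simp: dual_space_def linear_on_def)

lemma dualA_diff:
  assumes "p \<in> dualA"
  shows "p (x - y) = p x - p y"
  using dualA_D(1)[OF assms, of "x - y" y] by simp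

lemma dualV_closed:
  "(0 :: 'v \<Rightarrow> 'k) \<in> dualV"
  "w \<in> dualV \<Longrightarrow> w' \<in> dualV \<Longrightarrow> w + w' \<in> dualV"
  "w \<in> dualV \<Longrightarrow> fun_scale c w \<in> dualV"
  by (auto simp: dual_space_def linear_on_def fun_scale_def algebra_simps)

lemma zero_in_dualA: "(\<lambda>_. 0) \<in> dualA"
  by (simp add: dual_space_def linear_on_def)

lemma fun_scale_apply: "fun_scale c w x = c * w x"
  by (simp add: fun_scale_def)

lemma dual_basis_in_dualV: "dual_basis sV BV e \<in> dualV"
  by (simp add: dual_space_def linear_on_def dual_basis_def W.representation_add
      W.representation_scale W.independent_Basis W.span_Basis)

lemma sum_dual_basis_vector: "(\<Sum>e\<in>BV. sV (dual_basis sV BV e x) e) = x"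
  unfolding dual_basis_def
  by (rule W.sum_representation_eq) (simp_all add: W.independent_Basis W.span_Basis W.finite_Basis)

lemma dualV_sum:
  assumes w: "w \<in> dualV"
  shows "w (\<Sum>e\<in>S. sV (g e) (h e)) = (\<Sum>e\<in>S. g e * w (h e))"
  using sum_additive_on[of UNIV w S "\<lambda>e. sV (g e) (h e)"] dualV_D[OF w] dualV_D(2)[OF w, of 0 0]
  by simp

lemma sum_dual_basis:
  assumes w: "w \<in> dualV"
  shows "(\<Sum>e\<in>BV. w e * dual_basis sV BV e x) = w x"
  using dualV_sum[OF w, where g = "\<lambda>e. dual_basis sV BV e x" and h = "\<lambda>e. e" and S = BV]
  by (simp add: sum_dual_basis_vector mult.commute)

text \<open>The coordinates of a vector are values of the dual basis functionals, and they determine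
  it.\<close>

lemma dualV_separates:
  assumes "\<And>w. w \<in> dualV \<Longrightarrow> w x = w y"
  shows "x = y"
proof -
  have "x = (\<Sum>e\<in>BV. sV (dual_basis sV BV e x) e)"
    by (rule sum_dual_basis_vector[symmetric])
  also have "\<dots> = (\<Sum>e\<in>BV. sV (dual_basis sV BV e y) e)"
    by (simp only: assms[OF dual_basis_in_dualV])
  finally show ?thesis by (simp only: sum_dual_basis_vector)
qed

section \<open>Coordinates on the dual of the semidirect product\<close>

lemma hat_functional_apply:
  "\<Phi> p x (a, w) = (if w \<in> dualV then p a + w x else 0)"
  by (simp add: hat_functional_def)

lemma hat_functional_in_dual:
  assumes "p \<in> dualA"
  shows "\<Phi> p x \<in> dual_space hs H"
  by (auto simp: dual_space_def[of hs] linear_on_def hat_functional_apply hat_carrier_def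
      hat_scale_def dualV_closed fun_scale_apply dualA_D[OF assms] algebra_simps)

text \<open>The coordinate \<open>p\<close> is the restriction of \<open>F\<close> to A. The
  restriction to the dual of V is an element of the bidual, and finite dimension makes it evaluation
  at a vector.\<close>

lemma hat_functional_cases:
  assumes F: "F \<in> dual_space hs H"
  obtains p x where "p \<in> dualA" "F = \<Phi> p x"
proof -
  define p where "p = (\<lambda>a. F (a, 0))"
  \<comment> \<open>Evaluation at \<open>x\<close> has to agree with \<open>F\<close> on the dual
    basis, which prescribes the coordinates of \<open>x\<close>.\<close>
  define x where "x = (\<Sum>e\<in>BV. sV (F (0, dual_basis sV BV e)) e)"
  have add: "F (X + Y) = F X + F Y" if "X \<in> H" "Y \<in> H" for X Y
    using F that by (auto simp: dual_space_def linear_on_def)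
  have scale: "F (hs c X) = c * F X" if "X \<in> H" for c X
    using F that by (auto simp: dual_space_def linear_on_def)
  have H: "(a, w) \<in> H \<longleftrightarrow> w \<in> dualV" for a w by (simp add: hat_carrier_def)
  have p: "p \<in> dualA"
    using add[of "(_, 0)" "(_, 0)"] scale[of "(_, 0)"]
    by (auto simp: p_def dual_space_def[of sA] linear_on_def H dualV_closed hat_scale_def)
  have F0: "F (0, w) = w x" if w: "w \<in> dualV" for w
  proof -
    have zero: "F (0, 0) = 0"
      using scale[of "(0, 0)" 0] by (simp add: H dualV_closed hat_scale_def)
    \<comment> \<open>The argument is the expansion of \<open>w\<close> in the dual basis.\<close>
    have "F (0, \<Sum>e\<in>BV. fun_scale (w e) (dual_basis sV BV e))
        = (\<Sum>e\<in>BV. F (0, fun_scale (w e) (dual_basis sV BV e)))"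
    proof (rule sum_additive_on[where G = "\<lambda>w. F (0, w)" and D = dualV, THEN conjunct2])
      show "F (0, u + v) = F (0, u) + F (0, v)" if "u \<in> dualV" "v \<in> dualV" for u v
        using that add[of "(0, u)" "(0, v)"] by (simp add: H)
    qed (simp_all add: zero dualV_closed dual_basis_in_dualV)
    moreover have "F (0, fun_scale (w e) (dual_basis sV BV e)) = w e * F (0, dual_basis sV BV e)" for e
      using scale[of "(0, dual_basis sV BV e)" "w e"]
      by (simp add: H dual_basis_in_dualV hat_scale_def)
    moreover have "(\<Sum>e\<in>BV. fun_scale (w e) (dual_basis sV BV e)) = w"
      by (simp add: fun_eq_iff sum_fun_scale_apply sum_dual_basis[OF w])
    ultimately show ?thesis by (simp add: x_def dualV_sum[OF w] mult.commute)
  qed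
  have "F = \<Phi> p x"
  proof
    fix X :: "'a \<times> ('v \<Rightarrow> 'k)"
    obtain a w where X: "X = (a, w)" by fastforce
    show "F X = \<Phi> p x X"
    proof (cases "w \<in> dualV")
      case True
      then show ?thesis
        using add[of "(a, 0)" "(0, w)"] F0[OF True]
        by (simp add: X H dualV_closed p_def hat_functional_apply)
    next
      case False
      then show ?thesis using F by (simp add: X H dual_space_def[of hs] hat_functional_apply)
    qed
  qed
  with p show thesis by (rule that)
qed

text \<open>Rewriting with this equivalence turns each condition over the dual of the semidirect
  product into one over pairs of coordinates.\<close>

lemma ball_dual_hat:
  "(\<forall>F \<in> dual_space hs H. P F) \<longleftrightarrow> (\<forall>p\<in>dualA. \<forall>x. P (\<Phi> p x))"
proof
  assume *: "\<forall>p\<in>dualA. \<forall>x. P (\<Phi> p x)"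
  show "\<forall>F \<in> dual_space hs H. P F"
  proof
    fix F assume "F \<in> dual_space hs H"
    then obtain p x where "p \<in> dualA" "F = \<Phi> p x" by (rule hat_functional_cases)
    with * show "P F" by simp
  qed
qed (simp add: hat_functional_in_dual)

lemma ball_hat_carrier: "(\<forall>X\<in>H. P X) \<longleftrightarrow> (\<forall>a. \<forall>w\<in>dualV. P (a, w))"
  by (auto simp: hat_carrier_def)

text \<open>Testing on \<open>(a, 0)\<close> recovers \<open>p\<close>, and testing on
  \<open>(0, w)\<close> recovers \<open>x\<close> because \<open>dualV\<close> separates points.
  Through this, equations between functionals yield equations in V.\<close>

lemma hat_functional_eq_iff: "\<Phi> p x = \<Phi> q y \<longleftrightarrow> p = q \<and> x = y"
proof
  assume eq: "\<Phi> p x = \<Phi> q y"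
  have "p a = q a" for a
    using fun_cong[OF eq, of "(a, 0)"] by (simp add: hat_functional_apply dualV_closed)
  moreover have "w x = w y" if "w \<in> dualV" for w
    using fun_cong[OF eq, of "(0, w)"] that \<open>p 0 = q 0\<close> by (simp add: hat_functional_apply)
  ultimately show "p = q \<and> x = y" using dualV_separates by blast
qed simp

lemma hat_functional_add: "\<Phi> p x + \<Phi> q y = \<Phi> (\<lambda>a. p a + q a) (x + y)"
  by (auto simp: fun_eq_iff hat_functional_apply dualV_D)

lemma hat_functional_scale: "fun_scale c (\<Phi> p x) = \<Phi> (\<lambda>a. c * p a) (sV c x)"
  by (auto simp: fun_eq_iff hat_functional_apply dualV_D fun_scale_def algebra_simps)

section \<open>The dual regular actions in coordinates\<close>

lemma dual_action_UNIV: "dual_action UNIV act a f = (\<lambda>v. f (act a v))"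
  by (simp add: dual_action_def)

lemma dual_action_in_dualV:
  assumes "w \<in> dualV"
  shows "dual_action UNIV r a w \<in> dualV" "dual_action UNIV l a w \<in> dualV"
  using assms by (auto simp: dual_space_def linear_on_def dual_action_def module_linear)

lemma hat_functional_mult:
  assumes "w \<in> dualV" "w' \<in> dualV"
  shows "\<Phi> p x (hm (b, w') (a, w)) = p (mult b a) + w (r b x) + w' (l a x)"
proof -
  have "dual_action UNIV r b w + dual_action UNIV l a w' \<in> dualV"
    by (simp add: assms dualV_closed dual_action_in_dualV)
  then show ?thesis
    by (simp add: hat_mult_def hat_functional_apply) (simp add: dual_action_UNIV)
qed

text \<open>At \<open>(b, w')\<close> the left side is
  \<open>\<Phi> p x (hm (b, w') (a, w))\<close>. Its only term in \<open>w'\<close> is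
  \<open>w' (l a x)\<close>, which gives the vector coordinate; the terms in \<open>b\<close> form
  the coordinate on A.\<close>

lemma dual_left_hat_functional:
  assumes "w \<in> dualV"
  shows "dual_left (a, w) (\<Phi> p x) = \<Phi> (\<lambda>b. p (mult b a) + w (r b x)) (l a x)"
  using assms by (auto simp: fun_eq_iff dual_action_def right_mult_def hat_carrier_def
      hat_functional_mult hat_functional_apply)

lemma dual_right_hat_functional:
  assumes "w \<in> dualV"
  shows "dual_right (a, w) (\<Phi> p x) = \<Phi> (\<lambda>b. p (mult a b) + w (l b x)) (r a x)"
  using assms by (auto simp: fun_eq_iff dual_action_def left_mult_def hat_carrier_def
      hat_functional_mult hat_functional_apply)

text \<open>These are the A-coordinates produced by the two dual actions. Membership in
  \<open>dualA\<close> allows a map known only on such \<open>\<Phi> p x\<close> to be evaluated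
  after an action.\<close>

lemma dual_functional_in_dualA:
  assumes "p \<in> dualA" "w \<in> dualV"
  shows "(\<lambda>b. p (mult b a) + w (r b x)) \<in> dualA" "(\<lambda>b. p (mult a b) + w (l b x)) \<in> dualA"
  by (auto simp: dual_space_def[of sA] linear_on_def dualA_D[OF assms(1)] dualV_D[OF assms(2)]
      module_linear mult_linear algebra_simps)

lemma dualA_add: "p \<in> dualA \<Longrightarrow> q \<in> dualA \<Longrightarrow> (\<lambda>b. p b + q b) \<in> dualA"
  by (auto simp: dual_space_def linear_on_def algebra_simps)

lemma dualA_scale: "p \<in> dualA \<Longrightarrow> (\<lambda>b. c * p b) \<in> dualA"
  by (auto simp: dual_space_def linear_on_def algebra_simps)

section \<open>The tensors as linear maps\<close>

lemma comp_in_dualV: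
  assumes "p \<in> dualA" "linear_on sV UNIV sA UNIV \<gamma>"
  shows "(\<lambda>v. p (\<gamma> v)) \<in> dualV"
  using assms(2) by (auto simp: dual_space_def[of sV] linear_on_def dualA_D[OF assms(1)])

text \<open>The first tensor leg is paired with \<open>\<Phi> p x\<close>, which takes the value
  \<open>p (\<gamma> e)\<close> at \<open>(\<gamma> e, 0)\<close> and the e-th coordinate of
  \<open>x\<close> at the dual basis element. Hence \<gamma> contributes the expansion of
  \<open>p\<close> composed with \<gamma> in the dual basis, and its flip contributes
  \<open>\<gamma> x\<close>.\<close>

lemma tensor_maps:
  assumes lin: "linear_on sV UNIV sA UNIV \<gamma>" and p: "p \<in> dualA"
  shows "tensor_map hs (tensor_add (hom_tensor sA sV BV \<gamma>) (hom_tensor21 sA sV BV \<gamma>)) (\<Phi> p x)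
      = (\<gamma> x, \<lambda>v. p (\<gamma> v))" (is ?plus)
    and "tensor_map hs (tensor_diff (hom_tensor sA sV BV \<gamma>) (hom_tensor21 sA sV BV \<gamma>)) (\<Phi> p x)
      = (- \<gamma> x, \<lambda>v. p (\<gamma> v))" (is ?minus)
proof -
  have VH: "vector_space hs" by (rule vector_space_hat_scale) (rule vector_space_axioms)
  note dual = hat_functional_in_dual[OF p, of x]
  let ?t = "\<lambda>e. Poly_Mapping.single ((\<gamma> e, 0), (0 :: 'a, dual_basis sV BV e)) (1 :: 'k)"
  let ?t' = "\<lambda>e. Poly_Mapping.single ((0 :: 'a, dual_basis sV BV e), (\<gamma> e, 0)) (1 :: 'k)"
  have sum: "formal_map hs (sum t S) u = (\<Sum>e\<in>S. formal_map hs (t e) u)" for S :: "'v set" and t u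
    using sum_additive_on[of UNIV "\<lambda>p. formal_map hs p u" S t]
    by (simp add: formal_map_add[OF VH] formal_map_def[of _ 0])
  have "\<gamma> 0 = 0"
    using lin by (auto simp: linear_on_def dest!: spec[of _ 0] spec[of _ "0 :: 'k"])
  then have \<gamma>_sum: "\<gamma> (\<Sum>e\<in>S. sV (g e) e) = (\<Sum>e\<in>S. sA (g e) (\<gamma> e))" for S g
    using sum_additive_on[of UNIV \<gamma> S "\<lambda>e. sV (g e) e"] lin by (simp add: linear_on_def)
  have "formal_map hs (\<Sum>e\<in>BV. ?t e) (\<Phi> p x)
      = (\<Sum>e\<in>BV. (0, fun_scale (p (\<gamma> e)) (dual_basis sV BV e)))"
    by (simp add: sum formal_map_single[OF VH] hat_functional_apply dualV_closed
        hat_scale_def)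
  also have "\<dots> = (0, \<lambda>v. p (\<gamma> v))"
    using sum_dual_basis[OF comp_in_dualV[OF p lin]]
    by (simp add: prod_eq_iff fst_sum snd_sum fun_eq_iff sum_fun_scale_apply)
  finally have 1: "formal_map hs (\<Sum>e\<in>BV. ?t e) (\<Phi> p x) = (0, \<lambda>v. p (\<gamma> v))" .
  have "p 0 = 0" using dualA_D(2)[OF p, of 0 0] by simp
  then have "formal_map hs (\<Sum>e\<in>BV. ?t' e) (\<Phi> p x)
      = (\<Sum>e\<in>BV. (sA (dual_basis sV BV e x) (\<gamma> e), 0))"
    by (simp add: sum formal_map_single[OF VH] hat_functional_apply
        dual_basis_in_dualV hat_scale_def)
  also have "\<dots> = (\<gamma> (\<Sum>e\<in>BV. sV (dual_basis sV BV e x) e), 0)"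
    by (simp add: \<gamma>_sum prod_eq_iff fst_sum snd_sum)
  finally have 2: "formal_map hs (\<Sum>e\<in>BV. ?t' e) (\<Phi> p x) = (\<gamma> x, 0)"
    by (simp only: sum_dual_basis_vector)
  show ?plus
    by (simp add: hom_tensor_def hom_tensor21_def tensor_add_class tensor_map_class[OF VH dual]
        formal_map_add[OF VH] 1 2)
  show ?minus
    by (simp add: hom_tensor_def hom_tensor21_def tensor_diff_class tensor_map_class[OF VH dual]
        formal_map_diff[OF VH] 1 2)
qed

section \<open>Linearity and balanced homomorphisms\<close>

text \<open>Two maps are allowed because the antisymmetric tensor has -\<alpha> in the first
  component but the transpose of \<alpha>, without sign, in the second.\<close>

lemma linear_on_hat:
  assumes lin: "linear_on sV UNIV sA UNIV \<gamma>" and lin': "linear_on sV UNIV sA UNIV \<delta>"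
    and T: "\<And>p x. p \<in> dualA \<Longrightarrow> T (\<Phi> p x) = (\<gamma> x, \<lambda>v. p (\<delta> v))"
  shows "linear_on fun_scale (dual_space hs H) hs H T"
  unfolding linear_on_def ball_dual_hat hat_functional_add hat_functional_scale
  using lin[unfolded linear_on_def]
  by (auto simp: T dualA_add dualA_scale hat_carrier_def hat_scale_def comp_in_dualV[OF _ lin']
      fun_eq_iff fun_scale_def)

text \<open>In the dual component, left linearity of \<open>T\<close> compares
  \<open>w (r (\<beta> v) x)\<close> with \<open>w (l (\<beta> x) v)\<close>, and right linearity
  does the same with the sides exchanged. So balance of \<beta> already enters the homomorphism
  property of \<open>T\<close>, and it does so without the factor \<kappa>.\<close>

lemma balanced_hom_hat_iff:
  assumes lin: "linear_on sV UNIV sA UNIV \<beta>" and "\<kappa> \<noteq> 0"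
    and T: "\<And>p x. p \<in> dualA \<Longrightarrow> T (\<Phi> p x) = (\<beta> x, \<lambda>v. p (\<beta> v))"
  shows "balanced_hom hs H hm fun_scale (dual_space hs H) dual_left dual_right \<kappa> T
    \<longleftrightarrow> balanced_hom sA UNIV mult sV UNIV l r \<kappa> \<beta>" (is "?L \<longleftrightarrow> ?R")
proof
  assume ?L
  note L = this[unfolded balanced_hom_def ball_dual_hat ball_hat_carrier]
  \<comment> \<open>These are the first components at \<open>p = 0\<close> and
    \<open>w = 0\<close>.\<close>
  have "\<beta> (l a x) = mult a (\<beta> x)" "\<beta> (r a x) = mult (\<beta> x) a" for a x
    using L zero_in_dualA dualV_closed(1)
    by (auto simp: dual_left_hat_functional dual_right_hat_functional T hat_mult_def
        dest!: bspec[OF _ zero_in_dualA] bspec[OF _ dualV_closed(1)] spec[of _ a] spec[of _ x])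
  moreover have "sV \<kappa> (l (\<beta> x) y) = sV \<kappa> (r (\<beta> y) x)" for x y
  proof -
    \<comment> \<open>With zero functionals on A both A-coordinates vanish, so the equation reduces
      to its vector coordinates.\<close>
    have "fun_scale \<kappa> (dual_left (T (\<Phi> (\<lambda>_. 0) x)) (\<Phi> (\<lambda>_. 0) y))
        = fun_scale \<kappa> (dual_right (T (\<Phi> (\<lambda>_. 0) y)) (\<Phi> (\<lambda>_. 0) x))"
      using L zero_in_dualA by blast
    then show ?thesis
      using dualV_closed(1)
      by (simp add: T zero_in_dualA dual_left_hat_functional dual_right_hat_functional
          hat_functional_scale hat_functional_eq_iff zero_fun_def)
  qed
  ultimately show ?R using lin by (simp add: balanced_hom_def)
next
  assume ?R
  \<comment> \<open>The nonzero scalar \<kappa> is cancelled from the balance condition.\<close>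
  then have R: "\<beta> (l a x) = mult a (\<beta> x)" "\<beta> (r a x) = mult (\<beta> x) a"
    "l (\<beta> x) y = r (\<beta> y) x" for a x y
    using \<open>\<kappa> \<noteq> 0\<close> by (auto simp: balanced_hom_def)
  have "linear_on fun_scale (dual_space hs H) hs H T"
    by (rule linear_on_hat[OF lin lin T])
  then show ?L
    unfolding balanced_hom_def ball_dual_hat ball_hat_carrier
    by (simp add: T dual_left_hat_functional dual_right_hat_functional dual_functional_in_dualA
        comp_in_dualV[OF _ lin] hat_mult_def dual_action_UNIV hat_functional_scale
        hat_functional_eq_iff R cong: ball_cong)
      (simp add: fun_eq_iff add.commute)
qed

section \<open>The operator identity\<close>

definition defect :: "('v \<Rightarrow> 'a) \<Rightarrow> 'v \<Rightarrow> 'v \<Rightarrow> 'a" where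
  "defect \<alpha> x y = mult (\<alpha> x) (\<alpha> y) - \<alpha> (l (\<alpha> x) y + r (\<alpha> y) x)"

text \<open>In the first component the signs of -\<alpha> cancel. In the second, the terms with
  \<open>q\<close> are \<open>\<alpha> (r (\<alpha> x) v)\<close>, from the product, and
  \<open>mult (\<alpha> v) (\<alpha> x)\<close> and \<open>\<alpha> (l (\<alpha> v) x)\<close>, from
  the subtracted value of \<open>T\<close>. The sign of -\<alpha> is what makes them combine to
  \<open>defect \<alpha> v x\<close>; the terms with \<open>p\<close> combine likewise.\<close>

lemma defect_hat:
  assumes lin: "linear_on sV UNIV sA UNIV \<alpha>"
    and T: "\<And>p x. p \<in> dualA \<Longrightarrow> T (\<Phi> p x) = (- \<alpha> x, \<lambda>v. p (\<alpha> v))"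
    and p: "p \<in> dualA" and q: "q \<in> dualA"
  shows "hm (T (\<Phi> p x)) (T (\<Phi> q y))
      - T (dual_left (T (\<Phi> p x)) (\<Phi> q y) + dual_right (T (\<Phi> q y)) (\<Phi> p x))
    = (defect \<alpha> x y, \<lambda>v. q (defect \<alpha> v x) + p (defect \<alpha> y v))"
proof -
  have neg: "f (- x) = - f x" if "\<And>x y. f (x + y) = f x + f y"
    for f :: "'c::ab_group_add \<Rightarrow> 'd::ab_group_add" and x
    using that by (intro additive.minus additive.intro)
  have mult_neg: "mult (- a) b = - mult a b" "mult a (- b) = - mult a b" for a b
    using neg[of "\<lambda>a. mult a b"] neg[of "mult a"] by (simp_all add: mult_linear)
  have action_neg: "l (- a) v = - l a v" "r (- a) v = - r a v" for a v
    using neg[of "\<lambda>a. l a v"] neg[of "\<lambda>a. r a v"] by (simp_all add: module_linear)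
  have \<alpha>: "\<alpha> (u + v) = \<alpha> u + \<alpha> v" for u v
    using lin by (simp add: linear_on_def)
  have \<alpha>_neg: "\<alpha> (- v) = - \<alpha> v" for v
    by (rule neg[OF \<alpha>])
  have \<alpha>_diff: "\<alpha> (u - v) = \<alpha> u - \<alpha> v" for u v
    using \<alpha>[of "u - v" v] by simp
  have functional_neg: "p (- a) = - p a" "q (- a) = - q a" for a
    using neg[of p] neg[of q] by (simp_all add: dualA_D p q)
  \<comment> \<open>This is the A-coordinate of the sum of the two acted-on functionals, to which
    \<open>T\<close> is applied next.\<close>
  let ?u = "\<lambda>b. q (mult b (- \<alpha> x)) + p (\<alpha> (r b y)) + (p (mult (- \<alpha> y) b) + q (\<alpha> (l b x)))"
  note p\<alpha> = comp_in_dualV[OF p lin] and q\<alpha> = comp_in_dualV[OF q lin]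
  have u: "?u \<in> dualA"
    by (rule dualA_add[OF dual_functional_in_dualA(1)[OF q p\<alpha>] dual_functional_in_dualA(2)[OF p q\<alpha>]])
  have sum: "dual_left (T (\<Phi> p x)) (\<Phi> q y) + dual_right (T (\<Phi> q y)) (\<Phi> p x)
      = \<Phi> ?u (l (- \<alpha> x) y + r (- \<alpha> y) x)"
    by (simp only: T[OF p] T[OF q] dual_left_hat_functional[OF p\<alpha>]
        dual_right_hat_functional[OF q\<alpha>] hat_functional_add)
  show ?thesis
    unfolding sum T[OF u] unfolding T[OF p] T[OF q] hat_mult_def dual_action_UNIV defect_def
    by (simp add: fun_eq_iff mult_neg action_neg \<alpha> \<alpha>_neg \<alpha>_diff functional_neg dualA_D p q dualA_diff)
qed

lemma extended_O_operator_hat_iff: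
  assumes lin: "linear_on sV UNIV sA UNIV \<alpha>" and lin': "linear_on sV UNIV sA UNIV \<beta>"
    and S: "\<And>p x. p \<in> dualA \<Longrightarrow> S (\<Phi> p x) = (- \<alpha> x, \<lambda>v. p (\<alpha> v))"
    and T: "\<And>p x. p \<in> dualA \<Longrightarrow> T (\<Phi> p x) = (\<beta> x, \<lambda>v. p (\<beta> v))"
  shows "extended_O_operator sA UNIV mult sV UNIV l r \<alpha> \<beta> \<kappa> \<longleftrightarrow>
    extended_O_operator hs H hm fun_scale (dual_space hs H) dual_left dual_right S T \<kappa>"
proof -
  have "linear_on sV UNIV sA UNIV (\<lambda>x. - \<alpha> x)"
    using lin by (auto simp: linear_on_def)
  then have linS: "linear_on fun_scale (dual_space hs H) hs H S"
    by (rule linear_on_hat[OF _ lin S])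
  have p0: "p 0 = 0" if "p \<in> dualA" for p
    using dualA_D(2)[OF that, of 0 0] by simp
  show ?thesis
  proof (cases "\<kappa> = 0")
    case True
    \<comment> \<open>Forwards, the second component becomes \<open>q 0 + p 0\<close>; backwards,
      zero functionals serve as \<open>p\<close> and \<open>q\<close>, and the first component
      suffices.\<close>
    have "(\<forall>x y. defect \<alpha> x y = 0) \<longleftrightarrow>
      (\<forall>p\<in>dualA. \<forall>x. \<forall>q\<in>dualA. \<forall>y. (defect \<alpha> x y, \<lambda>v. q (defect \<alpha> v x) + p (defect \<alpha> y v)) = 0)"
      using zero_in_dualA by (auto simp: zero_prod_def fun_eq_iff p0)
    moreover have "O_operator sA UNIV mult sV UNIV l r \<alpha> \<longleftrightarrow> (\<forall>x y. defect \<alpha> x y = 0)"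
      using lin by (simp add: O_operator_def defect_def)
    moreover have "hm (S (\<Phi> p x)) (S (\<Phi> q y))
          = S (dual_left (S (\<Phi> p x)) (\<Phi> q y) + dual_right (S (\<Phi> q y)) (\<Phi> p x)) \<longleftrightarrow>
        (defect \<alpha> x y, \<lambda>v. q (defect \<alpha> v x) + p (defect \<alpha> y v)) = 0"
      if "p \<in> dualA" "q \<in> dualA" for p q x y
      by (simp only: eq_iff_diff_eq_0[of "hm _ _"] defect_hat[OF lin S that])
    then have "O_operator hs H hm fun_scale (dual_space hs H) dual_left dual_right S \<longleftrightarrow>
      (\<forall>p\<in>dualA. \<forall>x. \<forall>q\<in>dualA. \<forall>y. (defect \<alpha> x y, \<lambda>v. q (defect \<alpha> v x) + p (defect \<alpha> y v)) = 0)"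
      unfolding O_operator_def ball_dual_hat
      using linS by (simp cong: ball_cong)
    ultimately show ?thesis using True by (simp add: extended_O_operator_def)
  next
    case False
    \<comment> \<open>Assuming \<open>bal\<close> is harmless, since both sides of the final
      equivalence contain it as a conjunct.\<close>
    have "(\<forall>x y. defect \<alpha> x y = sA \<kappa> (mult (\<beta> x) (\<beta> y))) \<longleftrightarrow>
      (\<forall>p\<in>dualA. \<forall>x. \<forall>q\<in>dualA. \<forall>y. (defect \<alpha> x y, \<lambda>v. q (defect \<alpha> v x) + p (defect \<alpha> y v))
        = hs \<kappa> (hm (T (\<Phi> p x)) (T (\<Phi> q y))))"
      if bal: "balanced_hom sA UNIV mult sV UNIV l r \<kappa> \<beta>"
    proof -
      \<comment> \<open>The homomorphism property turns \<open>\<beta> (r (\<beta> x) v)\<close> and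
        \<open>\<beta> (l (\<beta> y) v)\<close> into products, so the right side gets the shape of
        the formula in \<open>defect_hat\<close>.\<close>
      have "hs \<kappa> (hm (T (\<Phi> p x)) (T (\<Phi> q y))) = (sA \<kappa> (mult (\<beta> x) (\<beta> y)),
          \<lambda>v. q (sA \<kappa> (mult (\<beta> v) (\<beta> x))) + p (sA \<kappa> (mult (\<beta> y) (\<beta> v))))"
        if "p \<in> dualA" "q \<in> dualA" for p q x y
        using bal that
        by (simp add: T balanced_hom_def hat_mult_def hat_scale_def dual_action_def
            fun_eq_iff fun_scale_def dualA_D algebra_simps)
      then show ?thesis using zero_in_dualA by auto
    qed
    moreover have "extended_O_operator sA UNIV mult sV UNIV l r \<alpha> \<beta> \<kappa> \<longleftrightarrow>
      balanced_hom sA UNIV mult sV UNIV l r \<kappa> \<beta> \<and>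
      (\<forall>x y. defect \<alpha> x y = sA \<kappa> (mult (\<beta> x) (\<beta> y)))"
      using lin False by (simp add: extended_O_operator_def defect_def)
    moreover have
      "extended_O_operator hs H hm fun_scale (dual_space hs H) dual_left dual_right S T \<kappa> \<longleftrightarrow>
      balanced_hom sA UNIV mult sV UNIV l r \<kappa> \<beta> \<and>
      (\<forall>p\<in>dualA. \<forall>x. \<forall>q\<in>dualA. \<forall>y. (defect \<alpha> x y, \<lambda>v. q (defect \<alpha> v x) + p (defect \<alpha> y v))
        = hs \<kappa> (hm (T (\<Phi> p x)) (T (\<Phi> q y))))"
      unfolding extended_O_operator_def ball_dual_hat
      using linS False
      by (simp add: defect_hat[OF lin S] balanced_hom_hat_iff[OF lin' False T]
          cong: ball_cong)
    ultimately show ?thesis by blast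
  qed
qed

end

theorem theorem3p16:
  fixes sA :: "'k::field \<Rightarrow> 'a::ab_group_add \<Rightarrow> 'a"
    and mult :: "'a \<Rightarrow> 'a \<Rightarrow> 'a"
    and sV :: "'k \<Rightarrow> 'v::ab_group_add \<Rightarrow> 'v"
    and l r :: "'a \<Rightarrow> 'v \<Rightarrow> 'v"
    and BA :: "'a set" and BV :: "'v set"
    and \<alpha> \<beta> :: "'v \<Rightarrow> 'a" and \<kappa> :: 'k
  assumes "algebra_on sA UNIV mult"
    and "bimodule_on sA UNIV mult sV UNIV l r"
    and "finite_dimensional_vector_space sA BA"
    and "finite_dimensional_vector_space sV BV"
    and "Vector_Spaces.linear sV sA \<alpha>"
    and "Vector_Spaces.linear sV sA \<beta>"
  defines "\<alpha>_minus \<equiv> tensor_diff (hom_tensor sA sV BV \<alpha>) (hom_tensor21 sA sV BV \<alpha>)"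
    and "\<beta>_plus \<equiv> tensor_add (hom_tensor sA sV BV \<beta>) (hom_tensor21 sA sV BV \<beta>)"
  shows "extended_O_operator sA UNIV mult sV UNIV l r \<alpha> \<beta> \<kappa> \<longleftrightarrow>
    extended_O_operator
      (hat_scale sA) (hat_carrier sV) (hat_mult mult l r)
      fun_scale (dual_space (hat_scale sA) (hat_carrier sV))
      (dual_action (hat_carrier sV) (right_mult (hat_mult mult l r)))
      (dual_action (hat_carrier sV) (left_mult (hat_mult mult l r)))
      (tensor_map (hat_scale sA) \<alpha>_minus)
      (tensor_map (hat_scale sA) \<beta>_plus)
      \<kappa>"
proof -
  interpret fd_bimodule sA mult sV l r BV
    by (intro fd_bimodule.intro assms(2,4))
  have lin: "linear_on sV UNIV sA UNIV \<gamma>" if "Vector_Spaces.linear sV sA \<gamma>" for \<gamma>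
    using that
    by (simp add: linear_on_def Vector_Spaces.linear_iff)
  show ?thesis
    unfolding \<alpha>_minus_def \<beta>_plus_def
    by (rule extended_O_operator_hat_iff) (simp_all add: lin assms(5,6) tensor_maps)
qed

end
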